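(* Let $f_1:\mathbb{R}^{n_1}\to\mathbb{R}$ be closed proper convex, $f_2:\mathbb{R}^{n_2}\to\mathbb{R}$ closed, proper and $\sigma$-strongly convex with $\sigma>0$, $A_1\in\mathbb{R}^{l\times n_1}$, $A_2\in\mathbb{R}^{l\times n_2}$, $b\in\mathbb{R}^l$, $\Omega=\{(x_1,x_2):A_1x_1+A_2x_2=b\}$. Let $\tau\in[\frac34,1]$, $r>\|A_2\|^2$, let $\beta^k>0$ satisfy $$\beta^k(\tau r\beta^k+\sigma)\ge\tau r(\beta^{k+1})^2,\qquad\beta^{k+1}\ge\beta^k\quad\text{for all }k,$$ and let $$D^k=\tau r\beta^kI_{n_2}-\beta^kA_2^TA_2,\qquad D_1^k=r\beta^kI_{n_2}-\beta^kA_2^TA_2.$$ Let $\{(x_1^k,x_2^k,\lambda^k)\}$ be generated by the linearized ADMM $$\begin{cases}x_1^{k+1}\in\arg\min_{x_1}L_{\beta^k}(x_1,x_2^k,\lambda^k),\\ x_2^{k+1}\in\arg\min_{x_2}\{L_{\beta^k}(x_1^{k+1},x_2,\lambda^k)+\frac12\|x_2-x_2^k\|^2_{D^k}\},\\ \lambda^{k+1}=\lambda^k-\beta^k(A_1x_1^{k+1}+A_2x_2^{k+1}-b),\end{cases}$$ put $v^k=(x_2^k,\lambda^k)$ and $\widetilde v^k=(\widetilde x_2^k,\widetilde\lambda^k)$ with $\widetilde x_2^k=x_2^{k+1}$, $\widetilde\lambda^k=\lambda^k-\beta^k(A_1x_1^{k+1}+A_2x_2^k-b)$, and $$H^k=\begin{pmatrix}\tau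 r\beta^kI_{n_2}&0\\0&\frac1{\beta^k}I_l\end{pmatrix},\quad G^k=\begin{pmatrix}D^k&0\\0&\frac1{\beta^k}I_l\end{pmatrix},\quad H_0^k=\begin{pmatrix}\tau r(\beta^k)^2I_{n_2}&0\\0&I_l\end{pmatrix}.$$ Then the convergence condition (CC3) holds with $r^k=\beta^k$, $R=I_{n_2}$, $z'=x_2'$, $z^k=x_2^{k+1}$, this $H_0^k$, and $$\Theta^k=\frac12\|x_2^{k-1}-x_2^k\|^2_{\tau\beta^kD_1^k+(1-\tau)(\beta^k)^2A_2^TA_2}:$$ that is, $r^k>0$, $H_0^k\succeq0$, $\Theta^k\ge0$, and for every $k\ge1$, every $x'=(x_1',x_2')\in\Omega$ and $\lambda\in\mathbb{R}^l$, with $v'=(x_2',\lambda)$, $$\begin{aligned}&\beta^k\left(\|v^{k+1}-v'\|^2_{H^k}+\sigma\|x_2^{k+1}-x_2'\|^2-\|v^k-v'\|^2_{H^k}+\|v^k-\widetilde v^k\|^2_{G^k}\right)\\ &\quad\ge\ \|v^{k+1}-v'\|^2_{H_0^{k+1}}-\|v^k-v'\|^2_{H_0^k}+\Theta^{k+1}-\Theta^k.\end{aligned}$$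
   Context: $\|y\|_D^2:=y^TDy$ for a symmetric matrix $D$, whether or not it is positive semidefinite ($D^k$ may be indefinite); $\|A_2\|$ is the spectral norm. $f_2$ is $\sigma$-strongly convex if $f_2(y)\ge f_2(x)+\langle f_2'(x),y-x\rangle+\frac\sigma2\|y-x\|^2$ for all $x,y$ and all $f_2'(x)\in\partial f_2(x)$. The augmented Lagrangian is $L_\beta(x_1,x_2,\lambda)=f_1(x_1)+f_2(x_2)-\lambda^T(A_1x_1+A_2x_2-b)+\frac\beta2\|A_1x_1+A_2x_2-b\|^2$. Iterations are indexed from $k=0$ with given $x_2^0,\lambda^0$. The general form of condition (CC3) is: for $r^k>0$, $H_0^k\succeq0$, $\Theta^k\ge0$, $$r^k\left(\|v^{k+1}-v'\|^2_{H^k}+\sigma\|z^k-z'\|^2_R-\|v^k-v'\|^2_{H^k}+\|v^k-\widetilde v^k\|^2_{G^k}\right)\ge\|v^{k+1}-v'\|^2_{H_0^{k+1}}-\|v^k-v'\|^2_{H_0^k}+\Theta^{k+1}-\Theta^k.$$ The minimization subproblems are assumed solvable, so that the sequence is well defined. *)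

theory Defs
  imports "HOL-Analysis.Analysis"
begin

text \<open>
  The squared (semi)norm $y^T D y$; \<open>D\<close> may be indefinite, so the value may be negative.
\<close>
definition qnorm :: "real^'n^'n \<Rightarrow> real^'n \<Rightarrow> real" where
  "qnorm D y = y \<bullet> (D *v y)"

definition psd :: "real^'n^'n \<Rightarrow> bool" where
  "psd D \<longleftrightarrow> transpose D = D \<and> (\<forall>y. 0 \<le> y \<bullet> (D *v y))"

text \<open>
  Vectors and block-diagonal matrices on $R^{n+m}$, with coordinates indexed by the
  disjoint sum of the two index types.
\<close>
definition stack :: "real^'n \<Rightarrow> real^'m \<Rightarrow> real^('n + 'm)" where
  "stack x y = (\<chi> i. case i of Inl a \<Rightarrow> x $ a | Inr c \<Rightarrow> y $ c)"

definition block_diag :: "real^'n^'n \<Rightarrow> real^'m^'m \<Rightarrow> real^('n + 'm)^('n + 'm)" where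
  "block_diag P Q = (\<chi> i j. case (i, j) of
      (Inl a, Inl b) \<Rightarrow> P $ a $ b
    | (Inr c, Inr d) \<Rightarrow> Q $ c $ d
    | _ \<Rightarrow> 0)"

text \<open>
  The objective functions are real-valued on the whole space, hence automatically proper.
\<close>
definition closed_convex :: "(real^'n \<Rightarrow> real) \<Rightarrow> bool" where
  "closed_convex f \<longleftrightarrow> closed (epigraph UNIV f) \<and> convex_on UNIV f"

definition subdifferential :: "(real^'n \<Rightarrow> real) \<Rightarrow> real^'n \<Rightarrow> (real^'n) set" where
  "subdifferential f x = {g. \<forall>y. f y \<ge> f x + g \<bullet> (y - x)}"

text \<open>
  Convexity is an explicit conjunct: the subgradient inequality alone is vacuous at points
  where the subdifferential is empty, so it would be satisfied by some nonconvex functions.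
\<close>
definition strongly_convex :: "real \<Rightarrow> (real^'n \<Rightarrow> real) \<Rightarrow> bool" where
  "strongly_convex \<sigma> f \<longleftrightarrow> convex_on UNIV f \<and>
     (\<forall>x y. \<forall>g \<in> subdifferential f x. f y \<ge> f x + g \<bullet> (y - x) + \<sigma> / 2 * (norm (y - x))\<^sup>2)"

definition aug_lagrangian ::
  "(real^'n \<Rightarrow> real) \<Rightarrow> (real^'m \<Rightarrow> real) \<Rightarrow> real^'n^'l \<Rightarrow> real^'m^'l \<Rightarrow> real^'l
    \<Rightarrow> real \<Rightarrow> real^'n \<Rightarrow> real^'m \<Rightarrow> real^'l \<Rightarrow> real" where
  "aug_lagrangian f1 f2 A1 A2 b \<beta> x1 x2 lam =
     f1 x1 + f2 x2 - lam \<bullet> (A1 *v x1 + A2 *v x2 - b)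
     + \<beta> / 2 * (norm (A1 *v x1 + A2 *v x2 - b))\<^sup>2"

definition feasible_set :: "real^'n^'l \<Rightarrow> real^'m^'l \<Rightarrow> real^'l \<Rightarrow> ((real^'n) \<times> (real^'m)) set" where
  "feasible_set A1 A2 b = {(x1, x2). A1 *v x1 + A2 *v x2 = b}"

text \<open>
  The convergence condition. The set \<open>W\<close> holds the admissible reference pairs $(v', z')$.
  The terms \<open>\<Theta> k\<close> depend on the iterates \<open>k - 1\<close> and \<open>k\<close>, so they are only
  meaningful for \<open>k \<ge> 1\<close>, and the value \<open>\<Theta> 0\<close> plays no role.
\<close>
definition CC3 ::
  "((real^'v) \<times> (real^'z)) set \<Rightarrow> real \<Rightarrow> real^'z^'z \<Rightarrow> (nat \<Rightarrow> real)
    \<Rightarrow> (nat \<Rightarrow> real^'v^'v) \<Rightarrow> (nat \<Rightarrow> real^'v^'v) \<Rightarrow> (nat \<Rightarrow> real^'v^'v) \<Rightarrow> (nat \<Rightarrow> real)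
    \<Rightarrow> (nat \<Rightarrow> real^'v) \<Rightarrow> (nat \<Rightarrow> real^'v) \<Rightarrow> (nat \<Rightarrow> real^'z) \<Rightarrow> bool" where
  "CC3 W \<sigma> R r H G H0 \<Theta> v vt z \<longleftrightarrow>
     (\<forall>k. r k > 0) \<and> (\<forall>k. psd (H0 k)) \<and> (\<forall>k\<ge>1. \<Theta> k \<ge> 0) \<and>
     (\<forall>k\<ge>1. \<forall>(v', z') \<in> W.
        r k * (qnorm (H k) (v (k + 1) - v') + \<sigma> * qnorm R (z k - z')
               - qnorm (H k) (v k - v') + qnorm (G k) (v k - vt k))
        \<ge> qnorm (H0 (k + 1)) (v (k + 1) - v') - qnorm (H0 k) (v k - v') + \<Theta> (k + 1) - \<Theta> k)"

end

theory Submission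
  imports Defs
begin

text \<open>
  Write \<open>d = x2 k - x2 (k + 1)\<close>, \<open>d' = x2 (k - 1) - x2 k\<close>, let \<open>w\<close> be the constraint residual
  at the new iterate, and abbreviate \<open>\<beta>\<^sub>0, \<beta>, \<beta>\<^sub>1\<close> for the penalties at \<open>k - 1, k, k + 1\<close>.

  The distances from the multipliers to the reference multiplier enter both sides of (CC3) in the
  same way, and for the \<open>x2\<close>-parts the left side exceeds the right one by
  \<open>\<beta> (\<tau> r \<beta> + \<sigma>) - \<tau> r \<beta>\<^sub>1\<^sup>2 \<ge> 0\<close> times the squared distance of \<open>x2 (k + 1)\<close> to its reference.
  So the reference point drops out, and what remains is a statement about two consecutive steps:
  \<open>\<beta>\<^sup>2 (\<tau> r |d|\<^sup>2 + |w|\<^sup>2 + 2 \<langle>w, A2 d\<rangle>) \<ge> \<Theta> (k + 1) - \<Theta> k\<close>.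

  Only \<open>\<langle>w, A2 d\<rangle>\<close> can be negative, and one copy of it is controlled by optimality. The
  proximal matrix \<open>D\<close> cancels the curvature of the penalty up to a multiple of the identity, so
  the \<open>x2\<close>-step yields the subgradient \<open>A2\<^sup>T lam (k + 1) + D k d\<close> of \<open>f2\<close> at \<open>x2 (k + 1)\<close>
  (\<open>x2_step_subgradient\<close>), also when \<open>D\<close> is indefinite. Strong monotonicity
  of the subdifferential between two consecutive iterates then bounds \<open>\<beta> \<langle>w, A2 d\<rangle>\<close> below by
  \<open>\<sigma> |d|\<^sup>2 + \<langle>d, D k d\<rangle> - \<langle>d, D (k - 1) d'\<rangle>\<close>.

  The mixed term is split by \<open>\<tau> r I - A2\<^sup>T A2 = \<tau> (r I - A2\<^sup>T A2) - (1 - \<tau>) A2\<^sup>T A2\<close>, a difference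
  of two positive semidefinite forms; their sum is the form in \<open>\<Theta>\<close>, and
  the inequality \<open>2 \<langle>x, y\<rangle> \<le> |x|\<^sup>2 + |y|\<^sup>2\<close> for each of them turns the mixed term into \<open>\<Theta>\<close>-terms (\<open>theta_form_polar\<close>).
  This costs \<open>2 (1 - \<tau>) |A2 d|\<^sup>2\<close>. The other copy of \<open>\<langle>w, A2 d\<rangle>\<close> is absorbed by \<open>|w|\<^sup>2\<close> at the
  cost of \<open>|A2 d|\<^sup>2 / 4\<close>. The available term \<open>\<tau> r |d|\<^sup>2 \<ge> \<tau> |A2 d|\<^sup>2\<close> pays for both exactly when
  \<open>\<tau> - 1/4 - 2 (1 - \<tau>) = 3 (\<tau> - 3/4) \<ge> 0\<close>, which is where \<open>3/4\<close> comes from. Finally, the growth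
  of the penalty in \<open>\<Theta> (k + 1)\<close> is paid for by half of the strong convexity term
  (\<open>two_step_inequality\<close>).
\<close>

section \<open>Quadratic forms and block matrices\<close>

lemma qnorm_scaleR: "qnorm (c *\<^sub>R M) x = c * qnorm M x"
  by (simp add: qnorm_def scaleR_matrix_vector_assoc[symmetric])

lemma qnorm_add: "qnorm (M + N) x = qnorm M x + qnorm N x"
  by (simp add: qnorm_def matrix_vector_mult_add_rdistrib inner_add_right)

lemma qnorm_diff: "qnorm (M - N) x = qnorm M x - qnorm N x"
  by (simp add: qnorm_def matrix_vector_mult_diff_rdistrib inner_diff_right)

lemma qnorm_mat_1: "qnorm (mat 1) x = (norm x)\<^sup>2"
  by (simp add: qnorm_def power2_norm_eq_inner)

lemma inner_transpose: "x \<bullet> (transpose A *v z) = (A *v x) \<bullet> z"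
  for A :: "real^'n^'m"
  using dot_lmul_matrix[of z A x] by (simp add: inner_commute)

lemma inner_Gram: "x \<bullet> ((transpose A ** A) *v y) = (A *v x) \<bullet> (A *v y)"
  for A :: "real^'n^'m"
  unfolding matrix_vector_mul_assoc[symmetric] inner_transpose ..

lemma qnorm_Gram: "qnorm (transpose A ** A) x = (norm (A *v x))\<^sup>2"
  for A :: "real^'n^'m"
  by (simp add: qnorm_def inner_Gram power2_norm_eq_inner)

lemmas qnorm_expand = qnorm_scaleR qnorm_add qnorm_diff qnorm_mat_1 qnorm_Gram

lemma sum_UNIV_sum:
  "(\<Sum>i\<in>UNIV. h i) = (\<Sum>a\<in>UNIV. h (Inl a)) + (\<Sum>c\<in>UNIV. h (Inr c))"
  for h :: "'a::finite + 'b::finite \<Rightarrow> real"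
  unfolding UNIV_Plus_UNIV[symmetric] by (subst sum.Plus) (simp_all add: comp_def)

lemma stack_diff: "stack x y - stack x' y' = stack (x - x') (y - y')"
  by (simp add: stack_def vec_eq_iff split: sum.split)

lemma qnorm_block_diag:
  "qnorm (block_diag P Q) (stack x y) = qnorm P x + qnorm Q y"
  by (simp add: qnorm_def block_diag_def stack_def inner_vec_def matrix_vector_mult_def
      sum_UNIV_sum)

lemma psd_block_diag_scaled_identity:
  assumes "0 \<le> a" "0 \<le> c"
  shows "psd (block_diag (a *\<^sub>R mat 1 :: real^'n^'n) (c *\<^sub>R mat 1 :: real^'m^'m))"
    (is "psd ?B")
  unfolding psd_def
proof (intro conjI allI)
  show "transpose ?B = ?B"
    by (auto simp: transpose_def block_diag_def vec_eq_iff mat_def split: sum.split)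
next
  fix u :: "real^('n + 'm)"
  have "u = stack (\<chi> i. u $ Inl i) (\<chi> i. u $ Inr i)"
    by (simp add: stack_def vec_eq_iff split: sum.split)
  then obtain x y where u: "u = stack x y" by blast
  have "qnorm ?B u = a * (norm x)\<^sup>2 + c * (norm y)\<^sup>2"
    by (simp add: u qnorm_block_diag qnorm_expand)
  with assms show "0 \<le> u \<bullet> (?B *v u)"
    by (simp add: qnorm_def)
qed

lemma norm_matrix_vector_sq_le:
  fixes A :: "real^'n^'m"
  assumes "(onorm (\<lambda>y. A *v y))\<^sup>2 \<le> r"
  shows "(norm (A *v x))\<^sup>2 \<le> r * (norm x)\<^sup>2"
proof -
  have "norm (A *v x) \<le> onorm (\<lambda>y. A *v y) * norm x"
    by (rule onorm) (rule matrix_vector_mul_bounded_linear)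
  then have "(norm (A *v x))\<^sup>2 \<le> (onorm (\<lambda>y. A *v y) * norm x)\<^sup>2"
    by (simp add: power_mono)
  also have "\<dots> \<le> r * (norm x)\<^sup>2"
    using assms by (simp add: power_mult_distrib mult_right_mono)
  finally show ?thesis .
qed

section \<open>Subgradients from minimization\<close>

text \<open>
  Moving from the minimizer a fraction \<open>t\<close> of the way towards \<open>y\<close> changes \<open>f\<close> by at most
  \<open>t (f y - f x)\<close> and the perturbation by its linear part up to \<open>O(t\<^sup>2)\<close>; dividing by \<open>t\<close> and
  letting \<open>t\<close> tend to 0 leaves the subgradient inequality.
\<close>
lemma minimizer_subgradient:
  fixes f h :: "real^'n \<Rightarrow> real"
  assumes f: "convex_on UNIV f"
    and min: "\<And>y. f x + h x \<le> f y + h y"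
    and h: "\<And>y. h y \<le> h x - g \<bullet> (y - x) + C * (norm (y - x))\<^sup>2"
  shows "g \<in> subdifferential f x"
  unfolding subdifferential_def
proof (intro CollectI allI)
  fix y
  let ?s = "f y - f x - g \<bullet> (y - x)" and ?c = "C * (norm (y - x))\<^sup>2"
  have step: "0 \<le> ?s + t * ?c" if t: "0 < t" "t < 1" for t
  proof -
    let ?z = "(1 - t) *\<^sub>R x + t *\<^sub>R y"
    have z: "?z - x = t *\<^sub>R (y - x)" by (simp add: algebra_simps)
    have "f ?z \<le> (1 - t) * f x + t * f y"
      using convex_onD[OF f, of t x y] t by simp
    moreover have "h ?z \<le> h x - t * (g \<bullet> (y - x)) + t\<^sup>2 * ?c"
      using h[of ?z] unfolding z by (simp add: power_mult_distrib mult.left_commute)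
    ultimately have "0 \<le> t * (?s + t * ?c)"
      using min[of ?z] by (simp add: algebra_simps power2_eq_square)
    with t show ?thesis by (simp add: zero_le_mult_iff)
  qed
  have "((\<lambda>t. ?s + t * ?c) \<longlongrightarrow> ?s + 0 * ?c) (at_right 0)"
    by (intro tendsto_intros)
  moreover have "eventually (\<lambda>t. 0 \<le> ?s + t * ?c) (at_right (0::real))"
    by (rule eventually_mono[OF eventually_at_right_real[OF zero_less_one]]) (auto intro: step)
  ultimately have "0 \<le> ?s + 0 * ?c"
    by (rule tendsto_lowerbound) simp
  then show "f y \<ge> f x + g \<bullet> (y - x)" by simp
qed

lemma strongly_convex_subdifferential_monotone:
  assumes "strongly_convex \<sigma> f" "g \<in> subdifferential f x" "g' \<in> subdifferential f x'"
  shows "\<sigma> * (norm (x - x'))\<^sup>2 \<le> (g - g') \<bullet> (x - x')"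
proof -
  have "f x' \<ge> f x + g \<bullet> (x' - x) + \<sigma> / 2 * (norm (x' - x))\<^sup>2"
    "f x \<ge> f x' + g' \<bullet> (x - x') + \<sigma> / 2 * (norm (x - x'))\<^sup>2"
    using assms unfolding strongly_convex_def by blast+
  then show ?thesis
    by (simp add: norm_minus_commute[of x'] algebra_simps)
qed

text \<open>
  The Hessian of the penalty, \<open>\<beta> A2\<^sup>T A2\<close>, and the proximal matrix add up to \<open>c I\<close>. Hence the smooth
  part of the subproblem is an exact multiple of \<open>|y - x|\<^sup>2\<close> above its linearization, and the
  optimality condition follows without any sign condition on the proximal matrix.
\<close>
lemma x2_step_subgradient:
  fixes A1 :: "real^'n1^'l" and A2 :: "real^'n2^'l"
  assumes f2: "convex_on UNIV f2"
    and D: "D = c *\<^sub>R mat 1 - \<beta> *\<^sub>R (transpose A2 ** A2)"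
    and min: "is_arg_min (\<lambda>y. aug_lagrangian f1 f2 A1 A2 b \<beta> u y lam + 1/2 * qnorm D (y - x0))
                (\<lambda>_. True) x"
  shows "transpose A2 *v (lam - \<beta> *\<^sub>R (A1 *v u + A2 *v x - b)) + D *v (x0 - x)
           \<in> subdifferential f2 x" (is "?g \<in> _")
proof -
  let ?w = "A1 *v u + A2 *v x - b"
  define h where "h y = aug_lagrangian f1 f2 A1 A2 b \<beta> u y lam + 1/2 * qnorm D (y - x0) - f2 y"
    for y
  show ?thesis
  proof (rule minimizer_subgradient[OF f2])
    fix y
    show "f2 x + h x \<le> f2 y + h y"
      using min by (simp add: h_def is_arg_min_linorder)
    define e where "e = y - x"
    define s where "s = x0 - x"
    define w where "w = ?w"
    have res: "A1 *v u + A2 *v y - b = w + A2 *v e"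
      by (simp add: w_def e_def matrix_vector_mult_diff_distrib)
    have y0: "y - x0 = e - s" and x0: "x - x0 = 0 - s" by (simp_all add: e_def s_def)
    have g: "(transpose A2 *v (lam - \<beta> *\<^sub>R w) + D *v s) \<bullet> e
        = (lam - \<beta> *\<^sub>R w) \<bullet> (A2 *v e) + c * (s \<bullet> e) - \<beta> * ((A2 *v s) \<bullet> (A2 *v e))"
      unfolding inner_commute[of _ e] inner_commute[of _ "A2 *v e"] D
        matrix_vector_mult_diff_rdistrib scaleR_matrix_vector_assoc[symmetric]
        inner_diff_right inner_add_right inner_scaleR_right inner_transpose inner_Gram
      by simp
    have "h y = h x - (transpose A2 *v (lam - \<beta> *\<^sub>R w) + D *v s) \<bullet> e + c / 2 * (norm e)\<^sup>2"
      unfolding g unfolding h_def aug_lagrangian_def res w_def[symmetric] y0 x0 D qnorm_expand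
        power2_norm_eq_inner matrix_vector_mult_diff_distrib
      by (simp add: inner_commute algebra_simps)
    then have "h y = h x - ?g \<bullet> (y - x) + c / 2 * (norm (y - x))\<^sup>2"
      by (simp only: e_def s_def w_def)
    then show "h y \<le> h x - ?g \<bullet> (y - x) + c / 2 * (norm (y - x))\<^sup>2" by simp
  qed
qed

section \<open>The estimate for two consecutive steps\<close>

text \<open>
  The form \<open>\<tau> (r I - A\<^sup>T A) + (1 - \<tau>) A\<^sup>T A\<close> behind \<open>\<Theta>\<close>, collected by powers of \<open>A\<close>.
\<close>
definition theta_form :: "real \<Rightarrow> real \<Rightarrow> real^'n^'m \<Rightarrow> real^'n \<Rightarrow> real" where
  "theta_form \<tau> r A x = \<tau> * r * (norm x)\<^sup>2 + (1 - 2 * \<tau>) * (norm (A *v x))\<^sup>2"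

lemma theta_form_scaleR: "theta_form \<tau> r A (c *\<^sub>R x) = c\<^sup>2 * theta_form \<tau> r A x"
  by (simp add: theta_form_def matrix_vector_mult_scaleR power_mult_distrib algebra_simps)

lemma theta_form_nonneg:
  fixes A :: "real^'n^'m"
  assumes "(norm (A *v x))\<^sup>2 \<le> r * (norm x)\<^sup>2" "0 \<le> \<tau>" "\<tau> \<le> 1"
  shows "0 \<le> theta_form \<tau> r A x"
proof -
  have "0 \<le> \<tau> * (r * (norm x)\<^sup>2 - (norm (A *v x))\<^sup>2) + (1 - \<tau>) * (norm (A *v x))\<^sup>2"
    using assms by simp
  then show ?thesis by (simp add: theta_form_def algebra_simps)
qed

text \<open>
  The gap between the two sides is the square of \<open>x - y\<close> in \<open>\<tau> (r I - A\<^sup>T A)\<close> plus the square of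
  \<open>x + y\<close> in \<open>(1 - \<tau>) A\<^sup>T A\<close>; the two signs are opposite because the form on the left is the
  difference of these two.
\<close>
lemma theta_form_polar:
  fixes A :: "real^'n^'m"
  assumes A: "\<And>x. (norm (A *v x))\<^sup>2 \<le> r * (norm x)\<^sup>2" and \<tau>: "0 \<le> \<tau>" "\<tau> \<le> 1"
  shows "2 * (\<tau> * r * (x \<bullet> y) - (A *v x) \<bullet> (A *v y)) \<le> theta_form \<tau> r A x + theta_form \<tau> r A y"
proof -
  have "0 \<le> \<tau> * (r * (norm (x - y))\<^sup>2 - (norm (A *v (x - y)))\<^sup>2)
      + (1 - \<tau>) * (norm (A *v (x + y)))\<^sup>2"
    using A[of "x - y"] \<tau> by simp
  also have "\<dots> = theta_form \<tau> r A x + theta_form \<tau> r A y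
      - 2 * (\<tau> * r * (x \<bullet> y) - (A *v x) \<bullet> (A *v y))"
    unfolding theta_form_def power2_norm_eq_inner matrix_vector_mult_diff_distrib
      matrix_vector_right_distrib inner_diff_left inner_diff_right inner_add_left inner_add_right
      inner_commute[of y x] inner_commute[of "A *v y" "A *v x"]
    by (simp add: algebra_simps)
  finally show ?thesis by simp
qed

text \<open>
  Here \<open>d'\<close> and \<open>d\<close> are two consecutive steps in the second block, taken with the penalties \<open>\<beta>\<^sub>0\<close>
  and \<open>\<beta>\<close>, and \<open>w\<close> is the residual after the later one. The hypothesis \<open>mono\<close> is what strong
  monotonicity of the subdifferential says about these two steps; of the two copies of
  \<open>\<langle>w, A d\<rangle>\<close> on the right it controls one, and the square \<open>|w|\<^sup>2\<close> the other.
\<close>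
lemma two_step_inequality:
  fixes A :: "real^'n^'m"
  assumes A: "\<And>x. (norm (A *v x))\<^sup>2 \<le> r * (norm x)\<^sup>2"
    and \<tau>: "3/4 \<le> \<tau>" "\<tau> \<le> 1" and r: "0 < r" and \<sigma>: "0 \<le> \<sigma>"
    and \<beta>: "0 \<le> \<beta>\<^sub>0" "\<beta>\<^sub>0 \<le> \<beta>" "0 < \<beta>"
    and growth: "\<tau> * r * \<beta>\<^sub>1\<^sup>2 \<le> \<beta> * (\<tau> * r * \<beta> + \<sigma>)"
    and mono: "\<sigma> * (norm d)\<^sup>2 \<le> \<beta> * (w \<bullet> (A *v d))
        - \<beta> * (\<tau> * r * (norm d)\<^sup>2 - (norm (A *v d))\<^sup>2)
        + \<beta>\<^sub>0 * (\<tau> * r * (d \<bullet> d') - (A *v d) \<bullet> (A *v d'))"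
  shows "\<beta>\<^sub>1\<^sup>2 / 2 * theta_form \<tau> r A d - \<beta>\<^sup>2 / 2 * theta_form \<tau> r A d'
      \<le> \<beta>\<^sup>2 * (\<tau> * r * (norm d)\<^sup>2 - (norm (A *v d))\<^sup>2 + (norm (w + A *v d))\<^sup>2)"
proof -
  let ?Q = "theta_form \<tau> r A" and ?N = "(norm d)\<^sup>2" and ?a = "(norm (A *v d))\<^sup>2"
    and ?p = "w \<bullet> (A *v d)" and ?m = "\<tau> * r * (d \<bullet> d') - (A *v d) \<bullet> (A *v d')"
  have \<tau>01: "0 \<le> \<tau>" "\<tau> \<le> 1" using \<tau> by auto
  have Q0: "0 \<le> ?Q x" for x by (rule theta_form_nonneg[OF A \<tau>01])
  \<comment> \<open>The weights belong to the vectors: the step \<open>\<beta>\<^sub>0 d'\<close> was taken with the older, smaller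
    penalty, so monotonicity of the penalty lets \<open>\<Theta>\<close> carry \<open>\<beta>\<close> instead.\<close>
  have "2 * (\<beta> * \<beta>\<^sub>0 * ?m) \<le> ?Q (\<beta> *\<^sub>R d) + ?Q (\<beta>\<^sub>0 *\<^sub>R d')"
    using theta_form_polar[OF A \<tau>01, of "\<beta> *\<^sub>R d" "\<beta>\<^sub>0 *\<^sub>R d'"]
    by (simp add: matrix_vector_mult_scaleR algebra_simps)
  also have "\<dots> \<le> \<beta>\<^sup>2 * ?Q d + \<beta>\<^sup>2 * ?Q d'"
    using \<beta> Q0[of d'] by (simp add: theta_form_scaleR mult_right_mono power_mono)
  finally have mixed: "2 * (\<beta> * \<beta>\<^sub>0 * ?m) \<le> \<beta>\<^sup>2 * ?Q d + \<beta>\<^sup>2 * ?Q d'" .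
  have "\<beta> * (\<sigma> * ?N) \<le> \<beta> * (\<beta> * ?p - \<beta> * (\<tau> * r * ?N - ?a) + \<beta>\<^sub>0 * ?m)"
    using mono \<beta> by (intro mult_left_mono) auto
  then have cross: "\<beta> * \<sigma> * ?N + \<beta>\<^sup>2 * (\<tau> * r * ?N - ?a) - \<beta> * \<beta>\<^sub>0 * ?m \<le> \<beta>\<^sup>2 * ?p"
    by (simp add: algebra_simps power2_eq_square)
  \<comment> \<open>Since \<open>\<tau> \<ge> 1/2\<close> gives \<open>?Q d \<le> \<tau> r |d|\<^sup>2\<close>, the growth of the penalty costs at most \<open>\<beta> \<sigma> |d|\<^sup>2\<close>.\<close>
  have "(\<beta>\<^sub>1\<^sup>2 - \<beta>\<^sup>2) * ?Q d \<le> \<beta> * \<sigma> * ?N"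
  proof -
    have "\<tau> * r * ((\<beta>\<^sub>1\<^sup>2 - \<beta>\<^sup>2) * ?Q d) = (\<tau> * r * (\<beta>\<^sub>1\<^sup>2 - \<beta>\<^sup>2)) * ?Q d"
      by (simp add: algebra_simps)
    also have "\<dots> \<le> (\<beta> * \<sigma>) * ?Q d"
      using growth Q0[of d] by (intro mult_right_mono) (auto simp: algebra_simps power2_eq_square)
    also have "\<dots> \<le> (\<beta> * \<sigma>) * (\<tau> * r * ?N)"
      using \<beta> \<sigma> \<tau> by (intro mult_left_mono) (auto simp: theta_form_def mult_nonpos_nonneg)
    finally have "\<tau> * r * ((\<beta>\<^sub>1\<^sup>2 - \<beta>\<^sup>2) * ?Q d) \<le> \<tau> * r * (\<beta> * \<sigma> * ?N)"
      by (simp add: algebra_simps)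
    then show ?thesis using \<tau> r by (simp add: mult_le_cancel_left_pos)
  qed
  moreover have "0 \<le> \<beta> * \<sigma> * ?N" using \<beta> \<sigma> by simp
  \<comment> \<open>Completing the square with the remaining copy of \<open>?p\<close>; the coefficient of \<open>?a\<close> left
    over after \<open>2 (1 - \<tau>)\<close> is \<open>3 (\<tau> - 3/4)\<close>.\<close>
  moreover have "0 \<le> \<beta>\<^sup>2 * (\<tau> * r * ?N + (norm w)\<^sup>2 + ?p - 2 * (1 - \<tau>) * ?a)"
  proof -
    have "0 \<le> (norm (w + (1/2) *\<^sub>R (A *v d)))\<^sup>2 + \<tau> * (r * ?N - ?a) + 3 * (\<tau> - 3/4) * ?a"
      using \<tau> A[of d] by simp
    also have "\<dots> = \<tau> * r * ?N + (norm w)\<^sup>2 + ?p - 2 * (1 - \<tau>) * ?a"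
      unfolding power2_norm_eq_inner inner_add_left inner_add_right
      by (simp add: inner_commute algebra_simps)
    finally show ?thesis by simp
  qed
  moreover have "(norm (w + A *v d))\<^sup>2 = (norm w)\<^sup>2 + 2 * ?p + ?a"
    unfolding power2_norm_eq_inner by (simp add: algebra_simps inner_commute)
  ultimately show ?thesis
    using mixed cross by (simp add: theta_form_def algebra_simps)
qed

section \<open>The convergence condition\<close>

theorem theorem3p4:
  fixes f1 :: "real^'n1 \<Rightarrow> real" and f2 :: "real^'n2 \<Rightarrow> real"
    and A1 :: "real^'n1^'l" and A2 :: "real^'n2^'l" and b :: "real^'l"
    and \<sigma> \<tau> r :: real and \<beta> \<Theta> :: "nat \<Rightarrow> real"
    and D D1 :: "nat \<Rightarrow> real^'n2^'n2"
    and x1 :: "nat \<Rightarrow> real^'n1" and x2 x2t :: "nat \<Rightarrow> real^'n2" and lam lamt :: "nat \<Rightarrow> real^'l"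
    and v vt :: "nat \<Rightarrow> real^('n2 + 'l)"
    and H G H0 :: "nat \<Rightarrow> real^('n2 + 'l)^('n2 + 'l)"
  assumes f1: "closed_convex f1"
    and f2: "closed_convex f2" "strongly_convex \<sigma> f2" and \<sigma>: "\<sigma> > 0"
    and \<tau>: "\<tau> \<in> {3/4..1}"
    and r: "r > (onorm (\<lambda>y. A2 *v y))\<^sup>2"
    and \<beta>_pos: "\<And>k. \<beta> k > 0"
    and \<beta>_growth: "\<And>k. \<beta> k * (\<tau> * r * \<beta> k + \<sigma>) \<ge> \<tau> * r * (\<beta> (k + 1))\<^sup>2"
    and \<beta>_mono: "\<And>k. \<beta> (k + 1) \<ge> \<beta> k"
    and D: "\<And>k. D k = (\<tau> * r * \<beta> k) *\<^sub>R mat 1 - \<beta> k *\<^sub>R (transpose A2 ** A2)"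
    and D1: "\<And>k. D1 k = (r * \<beta> k) *\<^sub>R mat 1 - \<beta> k *\<^sub>R (transpose A2 ** A2)"
    and x1_step: "\<And>k. is_arg_min (\<lambda>y. aug_lagrangian f1 f2 A1 A2 b (\<beta> k) y (x2 k) (lam k))
                     (\<lambda>_. True) (x1 (k + 1))"
    and x2_step: "\<And>k. is_arg_min (\<lambda>y. aug_lagrangian f1 f2 A1 A2 b (\<beta> k) (x1 (k + 1)) y (lam k)
                                       + 1/2 * qnorm (D k) (y - x2 k))
                     (\<lambda>_. True) (x2 (k + 1))"
    and lam_step: "\<And>k. lam (k + 1) = lam k - \<beta> k *\<^sub>R (A1 *v x1 (k + 1) + A2 *v x2 (k + 1) - b)"
    and x2t: "\<And>k. x2t k = x2 (k + 1)"
    and lamt: "\<And>k. lamt k = lam k - \<beta> k *\<^sub>R (A1 *v x1 (k + 1) + A2 *v x2 k - b)"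
    and v: "\<And>k. v k = stack (x2 k) (lam k)"
    and vt: "\<And>k. vt k = stack (x2t k) (lamt k)"
    and H: "\<And>k. H k = block_diag ((\<tau> * r * \<beta> k) *\<^sub>R mat 1) ((1 / \<beta> k) *\<^sub>R mat 1)"
    and G: "\<And>k. G k = block_diag (D k) ((1 / \<beta> k) *\<^sub>R mat 1)"
    and H0: "\<And>k. H0 k = block_diag ((\<tau> * r * (\<beta> k)\<^sup>2) *\<^sub>R mat 1) (mat 1)"
    and \<Theta>: "\<And>k. k \<ge> 1 \<Longrightarrow> \<Theta> k = 1/2 * qnorm ((\<tau> * \<beta> k) *\<^sub>R D1 k
                     + ((1 - \<tau>) * (\<beta> k)\<^sup>2) *\<^sub>R (transpose A2 ** A2)) (x2 (k - 1) - x2 k)"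
  shows "CC3 {(stack x2' lam', x2') | x1' x2' lam'. (x1', x2') \<in> feasible_set A1 A2 b}
           \<sigma> (mat 1) \<beta> H G H0 \<Theta> v vt (\<lambda>k. x2 (k + 1))"
proof -
  have A2_le: "(norm (A2 *v x))\<^sup>2 \<le> r * (norm x)\<^sup>2" for x
    using r by (intro norm_matrix_vector_sq_le) simp
  have r_pos: "0 < r" using r by (rule le_less_trans[OF zero_le_power2])
  have \<tau>': "3/4 \<le> \<tau>" "\<tau> \<le> 1" "0 \<le> \<tau>" using \<tau> by auto
  have conv: "convex_on UNIV f2" using f2(2) by (simp add: strongly_convex_def)

  have \<Theta>_eq: "\<Theta> k = (\<beta> k)\<^sup>2 / 2 * theta_form \<tau> r A2 (x2 (k - 1) - x2 k)" if "k \<ge> 1" for k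
    unfolding \<Theta>[OF that] D1 theta_form_def qnorm_expand
    by (simp add: algebra_simps power2_eq_square)

  have subgrad: "transpose A2 *v lam (k + 1) + D k *v (x2 k - x2 (k + 1))
      \<in> subdifferential f2 (x2 (k + 1))" for k
    using x2_step_subgradient[OF conv D x2_step] by (simp only: lam_step)

  have main: "\<Theta> (k + 1) - \<Theta> k \<le> \<beta> k * qnorm (D k) (x2 k - x2 (k + 1)) + (norm (lam k - lamt k))\<^sup>2"
    if k: "k \<ge> 1" for k
  proof -
    define d where "d = x2 k - x2 (k + 1)"
    define d' where "d' = x2 (k - 1) - x2 k"
    define w where "w = A1 *v x1 (k + 1) + A2 *v x2 (k + 1) - b"
    have k1: "k - 1 + 1 = k" using k by simp
    have D_form: "d \<bullet> (D j *v e) = \<beta> j * (\<tau> * r * (d \<bullet> e) - (A2 *v d) \<bullet> (A2 *v e))" for j e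
      unfolding D matrix_vector_mult_diff_rdistrib scaleR_matrix_vector_assoc[symmetric]
        inner_diff_right inner_scaleR_right inner_Gram
      by (simp add: algebra_simps)
    have "\<sigma> * (norm (x2 (k + 1) - x2 k))\<^sup>2
        \<le> (transpose A2 *v lam (k + 1) + D k *v d - (transpose A2 *v lam k + D (k - 1) *v d'))
            \<bullet> (x2 (k + 1) - x2 k)"
      using strongly_convex_subdifferential_monotone[OF f2(2) subgrad[of k] subgrad[of "k - 1"]]
      by (simp only: k1 d_def d'_def)
    also have "x2 (k + 1) - x2 k = - d" by (simp add: d_def)
    finally have "\<sigma> * (norm d)\<^sup>2 \<le> d \<bullet> (transpose A2 *v (lam k - lam (k + 1)))
        - d \<bullet> (D k *v d) + d \<bullet> (D (k - 1) *v d')"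
      by (simp add: inner_diff_left inner_add_left inner_commute[of d] matrix_vector_mult_diff_distrib)
    also have "d \<bullet> (transpose A2 *v (lam k - lam (k + 1))) = \<beta> k * (w \<bullet> (A2 *v d))"
      unfolding inner_transpose lam_step w_def[symmetric] by (simp add: inner_commute)
    finally have mono: "\<sigma> * (norm d)\<^sup>2 \<le> \<beta> k * (w \<bullet> (A2 *v d))
        - \<beta> k * (\<tau> * r * (norm d)\<^sup>2 - (norm (A2 *v d))\<^sup>2)
        + \<beta> (k - 1) * (\<tau> * r * (d \<bullet> d') - (A2 *v d) \<bullet> (A2 *v d'))"
      by (simp add: D_form power2_norm_eq_inner)
    have "\<beta> (k - 1) \<le> \<beta> k" using \<beta>_mono[of "k - 1"] by (simp only: k1)
    then have "(\<beta> (k + 1))\<^sup>2 / 2 * theta_form \<tau> r A2 d - (\<beta> k)\<^sup>2 / 2 * theta_form \<tau> r A2 d'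
        \<le> (\<beta> k)\<^sup>2 * (\<tau> * r * (norm d)\<^sup>2 - (norm (A2 *v d))\<^sup>2 + (norm (w + A2 *v d))\<^sup>2)"
      using \<tau>' r_pos \<sigma> \<beta>_pos \<beta>_growth mono
      by (intro two_step_inequality[OF A2_le]) (auto intro: less_imp_le)
    moreover have "lam k - lamt k = \<beta> k *\<^sub>R (w + A2 *v d)"
      by (simp add: lamt w_def d_def matrix_vector_mult_diff_distrib)
    then have "(norm (lam k - lamt k))\<^sup>2 = (\<beta> k)\<^sup>2 * (norm (w + A2 *v d))\<^sup>2"
      by (simp add: power_mult_distrib)
    moreover have "\<beta> k * qnorm (D k) d = (\<beta> k)\<^sup>2 * (\<tau> * r * (norm d)\<^sup>2 - (norm (A2 *v d))\<^sup>2)"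
      unfolding D qnorm_expand by (simp add: algebra_simps power2_eq_square)
    ultimately show ?thesis
      using \<Theta>_eq[of "k + 1"] \<Theta>_eq[OF k] by (simp add: d_def d'_def distrib_left)
  qed

  have CC3_ineq: "qnorm (H0 (k + 1)) (v (k + 1) - stack x' l) - qnorm (H0 k) (v k - stack x' l)
        + \<Theta> (k + 1) - \<Theta> k
      \<le> \<beta> k * (qnorm (H k) (v (k + 1) - stack x' l) + \<sigma> * qnorm (mat 1) (x2 (k + 1) - x')
          - qnorm (H k) (v k - stack x' l) + qnorm (G k) (v k - vt k))"
    if k: "k \<ge> 1" for k x' l
  proof -
    let ?X = "\<lambda>j. (norm (x2 j - x'))\<^sup>2" and ?L = "\<lambda>j. (norm (lam j - l))\<^sup>2"
    have b0: "\<beta> k \<noteq> 0" using \<beta>_pos[of k] by simp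
    have H0': "qnorm (H0 j) (v j - stack x' l) = \<tau> * r * (\<beta> j)\<^sup>2 * ?X j + ?L j" for j
      by (simp add: H0 v stack_diff qnorm_block_diag qnorm_expand)
    have H': "\<beta> k * qnorm (H k) (v j - stack x' l) = \<tau> * r * (\<beta> k)\<^sup>2 * ?X j + ?L j" for j
      using b0 by (simp add: H v stack_diff qnorm_block_diag qnorm_expand field_simps
          power2_eq_square)
    have G': "\<beta> k * qnorm (G k) (v k - vt k)
        = \<beta> k * qnorm (D k) (x2 k - x2 (k + 1)) + (norm (lam k - lamt k))\<^sup>2"
      using b0 unfolding G v vt x2t stack_diff qnorm_block_diag qnorm_scaleR qnorm_mat_1
      by (simp add: distrib_left)
    have "\<tau> * r * (\<beta> (k + 1))\<^sup>2 * ?X (k + 1) \<le> \<beta> k * (\<tau> * r * \<beta> k + \<sigma>) * ?X (k + 1)"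
      using \<beta>_growth by (intro mult_right_mono) auto
    then show ?thesis
      using main[OF k] unfolding H0' distrib_left right_diff_distrib H' G' qnorm_mat_1
      by (simp add: algebra_simps power2_eq_square)
  qed

  have "psd (H0 k)" for k
    using psd_block_diag_scaled_identity[of "\<tau> * r * (\<beta> k)\<^sup>2" 1] \<tau>' r_pos by (simp add: H0)
  moreover have "0 \<le> \<Theta> k" if "k \<ge> 1" for k
    using theta_form_nonneg[OF A2_le] \<tau>' by (simp add: \<Theta>_eq[OF that])
  ultimately show ?thesis
    using \<beta>_pos CC3_ineq by (auto simp: CC3_def)
qed

end
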